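(* Let $\boldsymbol{\Pi}\in\mathbb{C}^{N\times N}$ and $\boldsymbol{R}_{\rm s}\in\mathbb{C}^{N\times N}$ be Hermitian positive semidefinite, and consider the problem with variable $\boldsymbol{F}\in\mathbb{C}^{N\times L}$ $$\max_{\boldsymbol{F}}\ \boldsymbol{F}^{\rm H}\boldsymbol{\Pi}\boldsymbol{F}\quad\text{s.t.}\quad \boldsymbol{F}\boldsymbol{F}^{\rm H}\preceq\boldsymbol{R}_{\rm s}.$$ When $\boldsymbol{R}_{\rm s}$ is attainable, i.e. the rank of $\boldsymbol{R}_{\rm s}$ is not higher than the number of columns and the number of rows of $\boldsymbol{F}$, the optimal solution $\boldsymbol{F}_{\rm opt}$ of this problem is a square root of $\boldsymbol{R}_{\rm s}$, i.e. $\boldsymbol{F}_{\rm opt}\boldsymbol{F}_{\rm opt}^{\rm H}=\boldsymbol{R}_{\rm s}$.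
   Context: $(\cdot)^{\rm H}$ is the conjugate transpose and $\preceq$ is the Loewner order on Hermitian matrices. The matrix-valued maximization is understood as the maximization of the vector of ordered eigenvalues $\boldsymbol{\lambda}(\boldsymbol{F}^{\rm H}\boldsymbol{\Pi}\boldsymbol{F})$, whose $i$th entry is the $i$th largest eigenvalue (the two are equivalent because the constraint is unchanged when $\boldsymbol{F}$ is replaced by $\boldsymbol{F}\boldsymbol{Q}$ with $\boldsymbol{Q}$ unitary). A square root of $\boldsymbol{R}_{\rm s}$ here means a matrix $\boldsymbol{F}$ of the given size with $\boldsymbol{F}\boldsymbol{F}^{\rm H}=\boldsymbol{R}_{\rm s}$; it is not unique.
   Formalization: For semidefinite Π (e.g. Π = 0) an optimal F need not be a square root of R_s; proved: square roots exist and each is optimal for every semidefinite Π, while "every optimal solution is a square root" is asserted only for positive definite Π. *)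

theory Defs
  imports
    "Jordan_Normal_Form.Schur_Decomposition"
    "Jordan_Normal_Form.DL_Rank"
    "HOL-Computational_Algebra.Fundamental_Theorem_Algebra"
begin

(* mat_adjoint is the conjugate transpose; the equation forces A to be square. *)
definition hermitian :: "complex mat \<Rightarrow> bool" where
  "hermitian A \<longleftrightarrow> mat_adjoint A = A"

(* (A *\<^sub>v v) \<bullet>c v is v^H A v. In the order on complex, 0 \<le> z means that
   z is real and nonnegative. *)
definition positive_semidefinite :: "complex mat \<Rightarrow> bool" where
  "positive_semidefinite A \<longleftrightarrow>
     hermitian A \<and> (\<forall>v \<in> carrier_vec (dim_row A). 0 \<le> (A *\<^sub>v v) \<bullet>c v)"

definition positive_definite :: "complex mat \<Rightarrow> bool" where
  "positive_definite A \<longleftrightarrow>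
     hermitian A \<and>
     (\<forall>v \<in> carrier_vec (dim_row A). v \<noteq> 0\<^sub>v (dim_row A) \<longrightarrow> 0 < (A *\<^sub>v v) \<bullet>c v)"

(* The dimension condition is needed because B - A takes its dimensions from A alone. *)
definition loewner_le :: "complex mat \<Rightarrow> complex mat \<Rightarrow> bool" (infix "\<preceq>\<^sub>L" 50) where
  "A \<preceq>\<^sub>L B \<longleftrightarrow>
     dim_row A = dim_row B \<and> hermitian A \<and> hermitian B \<and> positive_semidefinite (B - A)"

(* Eigenvalues with algebraic multiplicity, in decreasing order: entry i (from 0) is the
   (i+1)-th largest. Taking real parts loses nothing for Hermitian A, the only use. *)
definition ordered_eigenvalues :: "complex mat \<Rightarrow> real list" where
  "ordered_eigenvalues A =
     rev (sorted_list_of_multiset (image_mset Re (proots (char_poly A))))"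

lemma length_ordered_eigenvalues:
  assumes "A \<in> carrier_mat n n"
  shows "length (ordered_eigenvalues A) = n"
proof -
  have "length (ordered_eigenvalues A) = size (mset (ordered_eigenvalues A))"
    by (rule size_mset [symmetric])
  also have "\<dots> = size (proots (char_poly A))"
    by (simp add: ordered_eigenvalues_def)
  also have "\<dots> = n"
    using degree_monic_char_poly[OF assms] by (simp add: size_proots_complex)
  finally show ?thesis .
qed

definition feasible :: "nat \<Rightarrow> nat \<Rightarrow> complex mat \<Rightarrow> complex mat \<Rightarrow> bool" where
  "feasible N L R F \<longleftrightarrow> F \<in> carrier_mat N L \<and> F * mat_adjoint F \<preceq>\<^sub>L R"

definition objective :: "complex mat \<Rightarrow> complex mat \<Rightarrow> real list" where
  "objective P F = ordered_eigenvalues (mat_adjoint F * P * F)"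

(* Maximization of the whole eigenvalue vector: all L ordered eigenvalues are simultaneously
   at least those of any other feasible matrix. *)
definition optimal_solution ::
    "nat \<Rightarrow> nat \<Rightarrow> complex mat \<Rightarrow> complex mat \<Rightarrow> complex mat \<Rightarrow> bool" where
  "optimal_solution N L P R F \<longleftrightarrow>
     feasible N L R F \<and>
     (\<forall>G. feasible N L R G \<longrightarrow> (\<forall>i < L. objective P G ! i \<le> objective P F ! i))"

definition square_root :: "nat \<Rightarrow> nat \<Rightarrow> complex mat \<Rightarrow> complex mat \<Rightarrow> bool" where
  "square_root N L R F \<longleftrightarrow> F \<in> carrier_mat N L \<and> F * mat_adjoint F = R"

end

theory Submission
  imports Defs
begin

text \<open>If \<open>G G\<^sup>H \<preceq> F F\<^sup>H\<close>, then each ordered eigenvalue of \<open>G\<^sup>H P G\<close> is at most the corresponding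
  one of \<open>F\<^sup>H P F\<close>; hence every square root of \<open>R\<close> is optimal. Conversely, an optimal \<open>F\<close>
  has the same objective as a square root, so comparing traces gives
  \<open>tr (P (R - F F\<^sup>H)) = 0\<close>, which for positive definite \<open>P\<close> and \<open>R - F F\<^sup>H \<succeq> 0\<close> forces
  \<open>F F\<^sup>H = R\<close>. A square root with \<open>L\<close> columns comes from the spectral decomposition
  of \<open>R\<close>, whose eigenvalues vanish from position \<open>rank R\<close> on.\<close>

section \<open>Unitary diagonalization of Hermitian matrices\<close>

lemma adjoint_carrier [simp]: "A \<in> carrier_mat m n \<Longrightarrow> mat_adjoint A \<in> carrier_mat n m"
  unfolding mat_adjoint_def by (auto simp: mat_of_rows_def)

lemma adjoint_dim [simp]:
  "dim_row (mat_adjoint A) = dim_col A" "dim_col (mat_adjoint A) = dim_row A"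
  unfolding mat_adjoint_def by auto

lemma adjoint_index [simp]:
  assumes "i < dim_col A" "j < dim_row A"
  shows "mat_adjoint A $$ (i, j) = conjugate (A $$ (j, i))"
  using assms unfolding mat_adjoint_def by (auto simp: mat_of_rows_def)

lemma adjoint_adjoint [simp]: "mat_adjoint (mat_adjoint A) = A"
  by (rule eq_matI) auto

lemma adjoint_mult:
  fixes A B :: "'a :: {conjugatable_field} mat"
  assumes "A \<in> carrier_mat m n" "B \<in> carrier_mat n k"
  shows "mat_adjoint (A * B) = mat_adjoint B * mat_adjoint A"
  using assms
  by (intro eq_matI)
    (auto simp: scalar_prod_def sum_conjugate conjugate_dist_mul mult.commute intro!: sum.cong)

lemma adjoint_mult_vec:
  fixes A :: "complex mat"
  assumes "A \<in> carrier_mat m n" "x \<in> carrier_vec n" "y \<in> carrier_vec m"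
  shows "(A *\<^sub>v x) \<bullet>c y = x \<bullet>c (mat_adjoint A *\<^sub>v y)"
proof -
  have "(A *\<^sub>v x) \<bullet>c y = (\<Sum>i<m. \<Sum>j<n. A $$ (i,j) * x $ j * cnj (y $ i))"
    using assms by (auto simp: scalar_prod_def sum_distrib_right atLeast0LessThan intro!: sum.cong)
  also have "\<dots> = (\<Sum>j<n. \<Sum>i<m. A $$ (i,j) * x $ j * cnj (y $ i))"
    by (rule sum.swap)
  also have "\<dots> = x \<bullet>c (mat_adjoint A *\<^sub>v y)"
    using assms
    by (auto simp: scalar_prod_def sum_distrib_left atLeast0LessThan mult_ac intro!: sum.cong)
  finally show ?thesis .
qed

lemma hermitian_congruence:
  assumes "hermitian A" "A \<in> carrier_mat n n" "S \<in> carrier_mat n k"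
  shows "hermitian (mat_adjoint S * A * S)"
proof -
  have "mat_adjoint (mat_adjoint S * A * S) = mat_adjoint S * mat_adjoint (mat_adjoint S * A)"
    using assms by (intro adjoint_mult) auto
  also have "mat_adjoint (mat_adjoint S * A) = mat_adjoint A * mat_adjoint (mat_adjoint S)"
    using assms by (intro adjoint_mult) auto
  also have "mat_adjoint S * \<dots> = mat_adjoint S * A * S"
    using assms by (simp add: hermitian_def assoc_mult_mat[of _ k n _ n _ k])
  finally show ?thesis
    by (simp add: hermitian_def)
qed

section \<open>Unitary matrices and the spectral theorem for Hermitian matrices\<close>

lemma unitary_right:
  fixes U :: "complex mat"
  assumes "U \<in> carrier_mat n n" "mat_adjoint U * U = 1\<^sub>m n"
  shows "U * mat_adjoint U = 1\<^sub>m n"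
  using assms by (meson adjoint_carrier mat_mult_left_right_inverse)

text \<open>A basis completion of \<open>v\<close>, orthogonalized by Gram-Schmidt, still starts
  with \<open>v\<close>. Scaling its vectors to unit length gives the columns of \<open>W\<close>,
  so column 0 is only a multiple of \<open>v\<close>, which is enough for eigenvectors.\<close>

lemma unitary_extension:
  fixes v :: "complex vec"
  assumes v: "v \<in> carrier_vec n" and v0: "v \<noteq> 0\<^sub>v n"
  obtains W c where "W \<in> carrier_mat n n" "mat_adjoint W * W = 1\<^sub>m n" "col W 0 = c \<cdot>\<^sub>v v"
proof -
  interpret cof_vec_space n "TYPE(complex)" .
  define b where "b = basis_completion v"
  define ws where "ws = gram_schmidt n b"
  from basis_completion[OF v v0, folded b_def]
  have dist_b: "distinct b" and indep: "\<not> lin_dep (set b)" and b: "set b \<subseteq> carrier_vec n"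
    and hdb: "hd b = v" and len_b: "length b = n"
    by auto
  have n: "n > 0" using v v0 by (cases n) auto
  with hdb len_b obtain vs where bv: "b = v # vs" by (cases b) auto
  from gram_schmidt_result[OF b dist_b indep refl, folded ws_def]
  have ws: "set ws \<subseteq> carrier_vec n" "corthogonal ws" "length ws = n"
    by (auto simp: len_b)
  from gram_schmidt_hd[OF v, of vs, folded bv] have hdws: "hd ws = v" unfolding ws_def .
  have ws0: "ws ! 0 = v" using hdws ws n by (cases ws) auto
  \<comment> \<open>\<open>corthogonal\<close> gives orthogonal nonzero vectors of arbitrary length.
    The value \<open>w \<bullet>c w\<close> is real but typed as complex, hence \<open>Re\<close>
    under the root.\<close>
  define c where "c w = complex_of_real (1 / sqrt (Re (w \<bullet>c w)))" for w :: "complex vec"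
  define W where "W = mat_of_cols n (map (\<lambda>w. c w \<cdot>\<^sub>v w) ws)"
  have wsi: "ws ! i \<in> carrier_vec n" if "i < n" for i
    using ws that by (metis nth_mem subsetD)
  have colW: "col W i = c (ws ! i) \<cdot>\<^sub>v ws ! i" if "i < n" for i
    unfolding W_def using that ws wsi by (subst col_mat_of_cols) auto
  have W: "W \<in> carrier_mat n n" unfolding W_def using ws by (auto simp: mat_of_cols_def)
  have "mat_adjoint W * W = 1\<^sub>m n"
  proof (rule eq_matI)
    fix i j assume "i < dim_row (1\<^sub>m n :: complex mat)" "j < dim_col (1\<^sub>m n :: complex mat)"
    then have i: "i < n" and j: "j < n" by auto
    \<comment> \<open>The indices swap because \<open>\<bullet>c\<close> conjugates its second
      argument.\<close>
    have "(mat_adjoint W * W) $$ (i, j) = col W j \<bullet>c col W i"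
      using W i j by (auto simp: scalar_prod_def mult.commute intro!: sum.cong)
    also have "\<dots> = c (ws ! j) * cnj (c (ws ! i)) * (ws ! j \<bullet>c ws ! i)"
      unfolding colW[OF i] colW[OF j] conjugate_smult_vec
      using wsi[OF i] wsi[OF j] by simp
    also have "\<dots> = (if i = j then 1 else 0)"
    proof (cases "i = j")
      case True
      have pos: "ws ! i \<bullet>c ws ! i > 0"
        using corthogonalD[OF ws(2), of i i] i ws(3)
        by (simp add: less_le) (metis conjugate_square_ge_0_vec)
      then have "Re (ws ! i \<bullet>c ws ! i) > 0" and Im: "Im (ws ! i \<bullet>c ws ! i) = 0"
        by (auto simp: less_complex_def)
      then have "(1 / sqrt (Re (ws ! i \<bullet>c ws ! i)))\<^sup>2 * Re (ws ! i \<bullet>c ws ! i) = 1"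
        by (simp add: power_divide)
      then show ?thesis using True Im
        by (simp add: c_def complex_eq_iff power2_eq_square)
    next
      case False
      then show ?thesis using corthogonalD[OF ws(2), of j i] i j ws(3) by simp
    qed
    finally show "(mat_adjoint W * W) $$ (i, j) = 1\<^sub>m n $$ (i, j)" using i j by simp
  qed (use W in auto)
  then show ?thesis using that[of W "c v"] W colW[of 0] n ws0 by auto
qed

lemma unitary_mult:
  fixes U V :: "complex mat"
  assumes "U \<in> carrier_mat n n" "mat_adjoint U * U = 1\<^sub>m n"
    and "V \<in> carrier_mat n n" "mat_adjoint V * V = 1\<^sub>m n"
  shows "mat_adjoint (U * V) * (U * V) = 1\<^sub>m n"
proof -
  have "mat_adjoint (U * V) * (U * V) = mat_adjoint V * (mat_adjoint U * U) * V"
    using assms(1,3)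
    by (simp add: adjoint_mult[of _ n n _ n] assoc_mult_mat[of _ n n _ n _ n]
        mult_carrier_mat[of _ n n _ n])
  then show ?thesis using assms by simp
qed

text \<open>Deflation, by induction on the eigenvalue list: a unitary \<open>W\<close> whose first
  column is an eigenvector for \<open>e\<close> turns \<open>A\<close> into a matrix with
  \<open>e\<close> in the corner, zeros in the rest of the first row and column, and a Hermitian
  block whose characteristic polynomial has one factor fewer. The order of \<open>es\<close> is left
  to the caller.\<close>

lemma hermitian_unitary_diagonalization_list:
  assumes "A \<in> carrier_mat n n" "hermitian A" "char_poly A = (\<Prod>e\<leftarrow>es. [:- e, 1:])"
  shows "\<exists>U \<in> carrier_mat n n. mat_adjoint U * U = 1\<^sub>m n \<and> A * U = U * mat_diag n ((!) es)"
  using assms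
proof (induction es arbitrary: n A)
  case Nil
  then have "n = 0" using degree_monic_char_poly[of A n] by simp
  then show ?case using Nil(1) by (intro bexI[of _ "1\<^sub>m 0"] conjI eq_matI) (auto simp: mat_diag_def)
next
  case (Cons e es n A)
  note A = Cons.prems(1)
  have cp: "char_poly A = [:- e, 1:] * (\<Prod>e\<leftarrow>es. [:- e, 1:])" using Cons.prems(3) by simp
  have "monic (\<Prod>e\<leftarrow>es. [:- e, 1:])" by (rule monic_prod_list) auto
  then have "degree (char_poly A) = Suc (degree (\<Prod>e\<leftarrow>es. [:- e, 1:]))"
    unfolding cp by (subst degree_mult_eq) auto
  with degree_monic_char_poly[OF A] obtain m where n: "n = Suc m" by metis
  have "eigenvalue A e" unfolding eigenvalue_root_char_poly[OF A] cp by simp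
  then obtain v where "eigenvector A v e" unfolding eigenvalue_def by auto
  then have v: "v \<in> carrier_vec n" "v \<noteq> 0\<^sub>v n" and Av: "A *\<^sub>v v = e \<cdot>\<^sub>v v"
    using A unfolding eigenvector_def by auto
  obtain W c where W: "W \<in> carrier_mat n n" and WW: "mat_adjoint W * W = 1\<^sub>m n"
    and W0: "col W 0 = c \<cdot>\<^sub>v v"
    using unitary_extension[OF v] by blast
  have WW': "W * mat_adjoint W = 1\<^sub>m n" by (rule unitary_right[OF W WW])
  define A' where "A' = mat_adjoint W * A * W"
  have A': "A' \<in> carrier_mat n n" unfolding A'_def using A W by auto
  have herm: "hermitian A'"
    unfolding A'_def by (rule hermitian_congruence[OF Cons.prems(2) A W])
  \<comment> \<open>Column 0 of \<open>A * W\<close> is \<open>e\<close> times column 0 of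
    \<open>W\<close>, and \<open>mat_adjoint W\<close> sends the latter to the first unit
    vector.\<close>
  have col0: "A' $$ (i, 0) = (if i = 0 then e else 0)" if i: "i < n" for i
  proof -
    have "A *\<^sub>v col W 0 = e \<cdot>\<^sub>v col W 0"
      unfolding W0 using A v Av by (simp add: mult_mat_vec smult_smult_assoc mult.commute)
    then have "col (A * W) 0 = e \<cdot>\<^sub>v col W 0"
      using A W n by (metis col_mult2 zero_less_Suc)
    then have "A' $$ (i, 0) = row (mat_adjoint W) i \<bullet> (e \<cdot>\<^sub>v col W 0)"
      unfolding A'_def using A W i n by (simp add: assoc_mult_mat[of _ n n _ n _ n])
    also have "\<dots> = e * (mat_adjoint W * W) $$ (i, 0)"
      using W i n by simp
    finally show ?thesis unfolding WW using i n by simp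
  qed
  have row0: "A' $$ (0, j) = 0" if j: "j < n" "j \<noteq> 0" for j
  proof -
    have "A' $$ (0, j) = mat_adjoint A' $$ (0, j)" using herm by (simp add: hermitian_def)
    also have "\<dots> = cnj (A' $$ (j, 0))" using A' n j by simp
    finally show ?thesis using col0 j by simp
  qed
  define B where "B = mat m m (\<lambda>(i, j). A' $$ (Suc i, Suc j))"
  have B: "B \<in> carrier_mat m m" unfolding B_def by simp
  define E where "E = mat 1 1 (\<lambda>_. e)"
  have E: "E \<in> carrier_mat 1 1" unfolding E_def by simp
  have A'_block: "A' = four_block_mat E (0\<^sub>m 1 m) (0\<^sub>m m 1) B"
    by (rule eq_matI) (use A' n col0 row0 in \<open>auto simp: E_def B_def\<close>)
  have "hermitian B"
    unfolding hermitian_def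
  proof (rule eq_matI)
    fix i j assume "i < dim_row B" "j < dim_col B"
    then have ij: "i < m" "j < m" using B by auto
    have "A' $$ (Suc i, Suc j) = mat_adjoint A' $$ (Suc i, Suc j)"
      using herm by (simp add: hermitian_def)
    also have "\<dots> = cnj (A' $$ (Suc j, Suc i))" using A' n ij by simp
    finally show "mat_adjoint B $$ (i, j) = B $$ (i, j)" using ij by (simp add: B_def)
  qed (use B in auto)
  \<comment> \<open>Similarity preserves the characteristic polynomial, the block form splits off
    the factor of \<open>E\<close>, and this nonzero linear factor cancels.\<close>
  moreover have "char_poly B = (\<Prod>e\<leftarrow>es. [:- e, 1:])"
  proof -
    have "similar_mat_wit A' A (mat_adjoint W) W"
      by (rule similar_mat_witI[of _ _ n]) (use WW WW' A A' W in \<open>auto simp: A'_def\<close>)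
    then have "char_poly A' = char_poly A"
      by (intro char_poly_similar) (auto simp: similar_mat_def)
    moreover have "char_poly A' = char_poly E * char_poly B"
      unfolding A'_block by (rule char_poly_four_block_zeros_col[OF E _ B]) simp
    moreover have "char_poly E = [:- e, 1:]"
      by (simp add: E_def char_poly_defs det_def sign_def)
    ultimately show ?thesis
      unfolding cp by (metis mult_cancel_left pCons_eq_0_iff zero_neq_one)
  qed
  ultimately obtain U where U: "U \<in> carrier_mat m m" and UU: "mat_adjoint U * U = 1\<^sub>m m"
    and BU: "B * U = U * mat_diag m ((!) es)"
    using Cons.IH[OF B] by blast
  \<comment> \<open>Bordering \<open>U\<close> by a 1 keeps the first eigenvector fixed while
    diagonalizing the block \<open>B\<close>; \<open>W * V\<close> is then the required unitary
    matrix.\<close>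
  define V where "V = four_block_mat (1\<^sub>m 1) (0\<^sub>m 1 m) (0\<^sub>m m 1) U"
  have V: "V \<in> carrier_mat n n" unfolding V_def n using U by (auto intro: four_block_carrier_mat)
  have adjV: "mat_adjoint V = four_block_mat (1\<^sub>m 1) (0\<^sub>m 1 m) (0\<^sub>m m 1) (mat_adjoint U)"
    by (rule eq_matI) (use U in \<open>auto simp: V_def\<close>)
  have VV: "mat_adjoint V * V = 1\<^sub>m n"
    unfolding adjV unfolding V_def n using U UU
    by (subst mult_four_block_mat[of _ 1 1 _ m _ m _ _ 1 _ m]) auto
  have D: "mat_diag n ((!) (e # es)) = four_block_mat E (0\<^sub>m 1 m) (0\<^sub>m m 1) (mat_diag m ((!) es))"
    by (rule eq_matI) (auto simp: mat_diag_def E_def n)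
  have A'V: "A' * V = V * mat_diag n ((!) (e # es))"
    unfolding A'_block D unfolding V_def using U B E BU
    by (simp add: mult_four_block_mat[of _ 1 1 _ m _ m _ _ 1 _ m]
        left_mult_zero_mat[OF mat_diag_dim])
  let ?D = "mat_diag n ((!) (e # es))"
  have "A * (W * V) = W * mat_adjoint W * (A * (W * V))"
    unfolding WW' using A W V by simp
  also have "\<dots> = W * (A' * V)"
    unfolding A'_def using A W V by (simp add: assoc_mult_mat[of _ n n _ n _ n])
  also have "\<dots> = W * V * ?D"
    unfolding A'V using W V by (simp add: assoc_mult_mat[of _ n n _ n _ n])
  finally show ?case
    using unitary_mult[OF W WW V VV] W V by (intro bexI[of _ "W * V"]) auto
qed

text \<open>The fundamental theorem of algebra, with no leading constant because characteristic
  polynomials are monic.\<close>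

lemma char_poly_factorization:
  fixes A :: "complex mat"
  assumes "A \<in> carrier_mat n n" "mset es = proots (char_poly A)"
  shows "char_poly A = (\<Prod>e\<leftarrow>es. [:- e, 1:])"
proof -
  have "char_poly A = smult (lead_coeff (char_poly A)) (\<Prod>e\<in>#mset es. [:- e, 1:])"
    unfolding assms(2) by (rule complex_poly_decompose_multiset [symmetric])
  moreover have "lead_coeff (char_poly A) = 1"
    using degree_monic_char_poly[OF assms(1)] by simp
  ultimately show ?thesis by (simp flip: prod_mset_prod_list)
qed

text \<open>Listing the roots by decreasing real part gives a diagonalization in the order of
  \<open>ordered_eigenvalues\<close>. The diagonal matrix is congruent to \<open>A\<close>, hence
  Hermitian, so the roots are real and taking \<open>Re\<close> changes nothing.\<close>

lemma hermitian_spectral: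
  assumes A: "A \<in> carrier_mat n n" and herm: "hermitian A"
  obtains U where "U \<in> carrier_mat n n" "mat_adjoint U * U = 1\<^sub>m n" "U * mat_adjoint U = 1\<^sub>m n"
    "A = U * mat_diag n (\<lambda>i. complex_of_real (ordered_eigenvalues A ! i)) * mat_adjoint U"
proof -
  obtain es0 where es0: "mset es0 = proots (char_poly A)" using ex_mset by blast
  \<comment> \<open>Sorting by the key \<open>Re\<close> keeps the complex roots themselves, as the
    factorization needs; their real parts then form \<open>ordered_eigenvalues A\<close>.\<close>
  define es where "es = rev (sort_key Re es0)"
  have es: "mset es = proots (char_poly A)" by (simp add: es_def es0)
  have "sorted (map Re (sort_key Re es0))" by simp
  then have ord: "ordered_eigenvalues A = map Re es"
    unfolding ordered_eigenvalues_def es_def es0[symmetric] rev_map[symmetric] mset_map[symmetric]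
      sorted_list_of_multiset_mset
    by (intro arg_cong[of _ _ rev] properties_for_sort) auto
  have len: "length es = n"
    using length_ordered_eigenvalues[OF A] ord by simp
  obtain U where U: "U \<in> carrier_mat n n" and UU: "mat_adjoint U * U = 1\<^sub>m n"
    and AU: "A * U = U * mat_diag n ((!) es)"
    using hermitian_unitary_diagonalization_list[OF A herm char_poly_factorization[OF A es]] by blast
  have UU': "U * mat_adjoint U = 1\<^sub>m n" by (rule unitary_right[OF U UU])
  have "mat_adjoint U * A * U = mat_adjoint U * (A * U)"
    using A U by (simp add: assoc_mult_mat[of _ n n _ n _ n])
  also have "\<dots> = mat_adjoint U * U * mat_diag n ((!) es)"
    unfolding AU using U by (simp add: assoc_mult_mat[of _ n n _ n _ n])
  also have "\<dots> = mat_diag n ((!) es)"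
    unfolding UU using left_mult_one_mat mat_diag_dim by blast
  finally have "mat_adjoint (mat_diag n ((!) es)) = mat_diag n ((!) es)"
    using hermitian_congruence[OF herm A U] by (simp add: hermitian_def)
  then have real: "cnj (es ! i) = es ! i" if "i < n" for i
    using adjoint_index[of i "mat_diag n ((!) es)" i] that by (simp add: mat_diag_def)
  have D: "mat_diag n ((!) es) = mat_diag n (\<lambda>i. complex_of_real (ordered_eigenvalues A ! i))"
    by (rule eq_matI) (use real len in \<open>auto simp: mat_diag_def ord complex_eq_iff\<close>)
  have "A = A * (U * mat_adjoint U)" unfolding UU' using A by simp
  also have "\<dots> = A * U * mat_adjoint U" using A U by (simp add: assoc_mult_mat[of _ n n _ n _ n])
  finally show ?thesis using that[OF U UU UU'] unfolding AU D by blast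
qed

section \<open>Rank and square roots\<close>

text \<open>The \<open>m\<close> rows of \<open>A\<close> are filled up to a square matrix by zero
  rows up to \<open>k\<close> and by unit rows from \<open>k\<close> on, which force the later
  coordinates to vanish; row \<open>m\<close> is zero, so the determinant is 0. This does the
  dimension counts for the rank and for the comparison of eigenvalues.\<close>

lemma wide_system_nontrivial_solution:
  fixes A :: "'a :: field mat"
  assumes A: "A \<in> carrier_mat m n" and m: "m < k" and k: "k \<le> n"
  obtains v where "v \<in> carrier_vec n" "v \<noteq> 0\<^sub>v n" "A *\<^sub>v v = 0\<^sub>v m"
    "\<And>j. k \<le> j \<Longrightarrow> j < n \<Longrightarrow> v $ j = 0"
proof -
  define B where
    "B = mat n n (\<lambda>(i, j). if i < m then A $$ (i, j) else if k \<le> i \<and> i = j then 1 else 0)"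
  have B: "B \<in> carrier_mat n n" by (simp add: B_def)
  have "B = mat\<^sub>r n n (\<lambda>i. if i = m then 0\<^sub>v n else row B i)"
    by (rule eq_matI) (use m k in \<open>auto simp: B_def\<close>)
  moreover have "det \<dots> = 0" using m k B by (intro det_row_0) auto
  ultimately have "det B = 0" by simp
  then obtain v where v: "v \<in> carrier_vec n" "v \<noteq> 0\<^sub>v n" and Bv: "B *\<^sub>v v = 0\<^sub>v n"
    using det_0_iff_vec_prod_zero_field[OF B] by blast
  have row: "row B i \<bullet> v = 0" if "i < n" for i
    using arg_cong[OF Bv, of "\<lambda>w. w $ i"] that B by simp
  have "A *\<^sub>v v = 0\<^sub>v m"
  proof (rule eq_vecI)
    fix i assume "i < dim_vec (0\<^sub>v m :: 'a vec)"
    then have i: "i < m" "i < n" using m k by auto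
    then have "row A i = row B i" using A by (intro eq_vecI) (auto simp: B_def)
    then show "(A *\<^sub>v v) $ i = 0\<^sub>v m $ i" using row i A by simp
  qed (use A in auto)
  moreover have "v $ j = 0" if j: "k \<le> j" "j < n" for j
  proof -
    have "row B j = unit_vec n j" using j m by (intro eq_vecI) (auto simp: B_def)
    then show ?thesis using row[OF j(2)] j v by simp
  qed
  ultimately show ?thesis using that v by blast
qed

text \<open>The columns of \<open>X\<close> are a maximal independent set of columns of
  \<open>A\<close>, and \<open>Y\<close> holds the coordinates of each column of \<open>A\<close> in
  it. Thus \<open>A\<close> kills every vector that satisfies the \<open>rank A\<close> equations
  given by \<open>Y\<close>.\<close>

lemma (in vec_space) rank_factorization:
  assumes A: "A \<in> carrier_mat n m"
  obtains X Y where "X \<in> carrier_mat n (rank A)" "Y \<in> carrier_mat (rank A) m" "A = X * Y"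
proof -
  have cols: "set (cols A) \<subseteq> carrier_vec n" using A cols_dim by blast
  obtain S where fin: "finite S" and max: "maximal S (\<lambda>T. T \<subseteq> set (cols A) \<and> lin_indpt T)"
    using maximal_exists_superset[of "set (cols A)" "\<lambda>T. T \<subseteq> set (cols A) \<and> lin_indpt T" "{}"]
    by (auto simp: finite_lin_indpt2)
  have rank: "rank A = card S" by (rule rank_card_indpt[OF A max])
  have S: "S \<subseteq> set (cols A)" "lin_indpt S" using max unfolding maximal_def by auto
  have S_carrier: "S \<subseteq> carrier_vec n" using S cols by blast
  obtain us where us: "set us = S" "distinct us" using fin finite_distinct_list by blast
  have len: "length us = rank A" using us rank distinct_card by fastforce
  define X where "X = mat_of_cols n us"
  have X: "X \<in> carrier_mat n (rank A)" by (simp add: X_def len[symmetric])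
  have cols_X: "cols X = us" unfolding X_def using us S_carrier by simp
  \<comment> \<open>Outside the span, \<open>w\<close> could be added to \<open>S\<close> without
    losing independence, against maximality.\<close>
  have in_span: "w \<in> span S" if w: "w \<in> set (cols A)" for w
  proof (rule ccontr)
    assume notin: "w \<notin> span S"
    have "w \<in> carrier_vec n" using w cols by blast
    then have "lin_indpt (insert w S)"
      using notin S S_carrier lin_dep_iff_in_span[of S w] span_mem[of S w] by auto
    then have "insert w S = S"
      using max w S(1) unfolding maximal_def by blast
    then show False using notin span_mem S_carrier by blast
  qed
  have "\<exists>y. y \<in> carrier_vec (rank A) \<and> X *\<^sub>v y = col A j" if j: "j < m" for j
  proof -
    have "col A j \<in> set (cols A)" using A j by (auto simp: cols_def)
    then obtain a where "lincomb a S = col A j"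
      using finite_in_span[OF fin, of "col A j"] S_carrier in_span by auto
    then have "X *\<^sub>v vec (rank A) (\<lambda>i. a (col X i)) = col A j"
      using mat_mult_eq_lincomb[OF X, of a] us cols_X by simp
    then show ?thesis by (intro exI[of _ "vec (rank A) (\<lambda>i. a (col X i))"]) simp
  qed
  then obtain y where y: "\<And>j. j < m \<Longrightarrow> y j \<in> carrier_vec (rank A)"
    "\<And>j. j < m \<Longrightarrow> X *\<^sub>v y j = col A j"
    by metis
  define Y where "Y = mat_of_cols (rank A) (map y [0..<m])"
  have Y: "Y \<in> carrier_mat (rank A) m" by (simp add: Y_def mat_of_cols_def)
  have "A = X * Y"
  proof (rule mat_col_eqI)
    fix j assume "j < dim_col (X * Y)"
    then have j: "j < m" using Y by simp
    have "col Y j = y j" unfolding Y_def using j y by (subst col_mat_of_cols) auto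
    then show "col A j = col (X * Y) j" using col_mult2[OF X Y j] y(2)[OF j] by simp
  qed (use A X Y in auto)
  then show ?thesis using that X Y by blast
qed

section \<open>Quadratic forms in spectral coordinates\<close>

lemma cscalar_prod_self: "v \<bullet>c v = complex_of_real (\<Sum>i<dim_vec v. (cmod (v $ i))\<^sup>2)"
  by (simp add: scalar_prod_def atLeast0LessThan complex_mult_cnj cmod_power2)

lemma unitary_cscalar_prod:
  fixes U :: "complex mat"
  assumes U: "U \<in> carrier_mat n n" "U * mat_adjoint U = 1\<^sub>m n"
    and v: "v \<in> carrier_vec n" and w: "w \<in> carrier_vec n"
  shows "(mat_adjoint U *\<^sub>v v) \<bullet>c (mat_adjoint U *\<^sub>v w) = v \<bullet>c w"
proof -
  have "(mat_adjoint U *\<^sub>v v) \<bullet>c (mat_adjoint U *\<^sub>v w)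
      = v \<bullet>c (U *\<^sub>v (mat_adjoint U *\<^sub>v w))"
    using U v w by (subst adjoint_mult_vec[of _ n n]) (auto intro: mult_mat_vec_carrier[of _ n n])
  also have "U *\<^sub>v (mat_adjoint U *\<^sub>v w) = w"
    using U w by (simp flip: assoc_mult_mat_vec[of U n n _ n])
  finally show ?thesis .
qed

lemma mat_diag_mult_vec:
  fixes x :: "'a :: semiring_1 vec"
  assumes "x \<in> carrier_vec n"
  shows "mat_diag n f *\<^sub>v x = vec n (\<lambda>i. f i * x $ i)"
proof (rule eq_vecI)
  fix i assume "i < dim_vec (vec n (\<lambda>i. f i * x $ i))"
  then have i: "i < n" by simp
  have "(mat_diag n f *\<^sub>v x) $ i = (\<Sum>j<n. (if i = j then f j else 0) * x $ j)"
    using i assms by (simp add: mat_diag_def scalar_prod_def atLeast0LessThan)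
  also have "\<dots> = (\<Sum>j<n. if i = j then f j * x $ j else 0)"
    by (intro sum.cong) auto
  finally show "(mat_diag n f *\<^sub>v x) $ i = vec n (\<lambda>i. f i * x $ i) $ i" using i by simp
qed (simp add: mat_diag_def)

lemma spectral_coordinates:
  fixes U :: "complex mat"
  assumes U: "U \<in> carrier_mat n n" "mat_adjoint U * U = 1\<^sub>m n"
    and v: "v \<in> carrier_vec n"
  shows "mat_adjoint U *\<^sub>v ((U * mat_diag n d * mat_adjoint U) *\<^sub>v v)
    = vec n (\<lambda>i. d i * (mat_adjoint U *\<^sub>v v) $ i)"
proof -
  have D: "mat_diag n d \<in> carrier_mat n n" by simp
  have "mat_adjoint U *\<^sub>v ((U * mat_diag n d * mat_adjoint U) *\<^sub>v v)
      = (mat_adjoint U * U) *\<^sub>v (mat_diag n d *\<^sub>v (mat_adjoint U *\<^sub>v v))"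
    using U(1) v D
    by (simp add: assoc_mult_mat_vec[of _ n n _ n] mult_carrier_mat[of _ n n _ n]
        mult_mat_vec_carrier[of _ n n] del: mat_diag_dim)
  also have "\<dots> = mat_diag n d *\<^sub>v (mat_adjoint U *\<^sub>v v)"
    unfolding U(2) using U(1) v D by (simp add: mult_mat_vec_carrier[of _ n n])
  also have "\<dots> = vec n (\<lambda>i. d i * (mat_adjoint U *\<^sub>v v) $ i)"
    using U(1) v by (intro mat_diag_mult_vec mult_mat_vec_carrier[of _ n n]) auto
  finally show ?thesis .
qed

text \<open>In the coordinates \<open>mat_adjoint U *\<^sub>v v\<close> the matrix \<open>A\<close>
  acts by the factors \<open>d i\<close>, and a unitary change of coordinates preserves inner
  products.\<close>

lemma spectral_form:
  fixes U :: "complex mat"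
  assumes U: "U \<in> carrier_mat n n" "mat_adjoint U * U = 1\<^sub>m n" "U * mat_adjoint U = 1\<^sub>m n"
    and A: "A = U * mat_diag n (\<lambda>i. complex_of_real (d i)) * mat_adjoint U"
    and v: "v \<in> carrier_vec n"
  shows "(A *\<^sub>v v) \<bullet>c v
      = complex_of_real (\<Sum>i<n. d i * (cmod ((mat_adjoint U *\<^sub>v v) $ i))\<^sup>2)" (is ?form)
    and "(A *\<^sub>v v) \<bullet>c (A *\<^sub>v v)
      = complex_of_real (\<Sum>i<n. (d i)\<^sup>2 * (cmod ((mat_adjoint U *\<^sub>v v) $ i))\<^sup>2)" (is ?square)
    and "v \<bullet>c v = complex_of_real (\<Sum>i<n. (cmod ((mat_adjoint U *\<^sub>v v) $ i))\<^sup>2)" (is ?norm)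
proof -
  have A_carrier: "A \<in> carrier_mat n n" unfolding A using U(1) by auto
  let ?x = "mat_adjoint U *\<^sub>v v"
  have x: "?x \<in> carrier_vec n" using U(1) v by (simp add: mult_mat_vec_carrier[of _ n n])
  have Av: "A *\<^sub>v v \<in> carrier_vec n" using A_carrier v by (simp add: mult_mat_vec_carrier[of _ n n])
  have coord: "mat_adjoint U *\<^sub>v (A *\<^sub>v v) = vec n (\<lambda>i. complex_of_real (d i) * ?x $ i)"
    unfolding A using U v by (intro spectral_coordinates)
  have "(A *\<^sub>v v) \<bullet>c v = vec n (\<lambda>i. complex_of_real (d i) * ?x $ i) \<bullet>c ?x"
    using unitary_cscalar_prod[OF U(1,3) Av v] coord by simp
  also have "\<dots> = (\<Sum>i<n. complex_of_real (d i) * (?x $ i * cnj (?x $ i)))"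
    using carrier_vecD[OF x]
    by (simp add: scalar_prod_def atLeast0LessThan mult.assoc del: dim_mult_mat_vec index_mult_mat_vec)
  also have "\<dots> = complex_of_real (\<Sum>i<n. d i * (cmod (?x $ i))\<^sup>2)"
    by (simp add: complex_mult_cnj cmod_power2 del: index_mult_mat_vec)
  finally show ?form .
  show ?square
    using unitary_cscalar_prod[OF U(1,3) Av Av] coord
    by (simp add: cscalar_prod_self norm_mult power_mult_distrib)
  show ?norm
    using unitary_cscalar_prod[OF U(1,3) v v] U(1) by (simp add: cscalar_prod_self)
qed

section \<open>Ordered eigenvalues of positive semidefinite matrices\<close>

lemma ordered_eigenvalues_decreasing:
  assumes "i \<le> j" "j < length (ordered_eigenvalues A)"
  shows "ordered_eigenvalues A ! j \<le> ordered_eigenvalues A ! i"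
  using assms unfolding ordered_eigenvalues_def
  by (simp add: rev_nth) (intro sorted_nth_mono; simp)

text \<open>The quadratic form at column \<open>i\<close> of \<open>U\<close>, whose spectral
  coordinates are a unit vector, has the eigenvalue of index \<open>i\<close> as its value.\<close>

lemma ordered_eigenvalues_nonneg:
  assumes A: "A \<in> carrier_mat n n" and psd: "positive_semidefinite A" and i: "i < n"
  shows "0 \<le> ordered_eigenvalues A ! i"
proof -
  have "hermitian A" using psd by (simp add: positive_semidefinite_def)
  then obtain U where U: "U \<in> carrier_mat n n" "mat_adjoint U * U = 1\<^sub>m n"
      "U * mat_adjoint U = 1\<^sub>m n"
    and spec: "A = U * mat_diag n (\<lambda>i. complex_of_real (ordered_eigenvalues A ! i)) * mat_adjoint U"
    using hermitian_spectral[OF A] by blast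
  have v: "col U i \<in> carrier_vec n" using U i by (intro col_carrier_vec) auto
  have "mat_adjoint U *\<^sub>v col U i = col (mat_adjoint U * U) i"
    using U i by (intro col_mult2[symmetric]) auto
  then have x: "mat_adjoint U *\<^sub>v col U i = unit_vec n i" using U i by simp
  have "0 \<le> (A *\<^sub>v col U i) \<bullet>c col U i" 
    using psd A v by (simp add: positive_semidefinite_def)
  also have "\<dots> = complex_of_real (\<Sum>j<n. ordered_eigenvalues A ! j * (cmod (unit_vec n i $ j))\<^sup>2)"
    unfolding spectral_form(1)[OF U spec v] x ..
  also have "(\<Sum>j<n. ordered_eigenvalues A ! j * (cmod (unit_vec n i $ j))\<^sup>2)
      = (\<Sum>j<n. if i = j then ordered_eigenvalues A ! j else 0)"
    using i by (intro sum.cong) auto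
  finally show ?thesis using i by (simp add: less_eq_complex_def)
qed

text \<open>With \<open>A = X * Y\<close> of inner dimension \<open>rank A\<close>, at most
  \<open>i\<close> equations on \<open>i + 1\<close> coordinates leave a nonzero \<open>x\<close> on
  the indices up to \<open>i\<close> that \<open>Y * U\<close> kills, so \<open>A\<close> kills
  \<open>U *\<^sub>v x\<close>. The eigenvalue at some \<open>j \<le> i\<close> with
  \<open>x $ j \<noteq> 0\<close> is therefore 0, and by monotonicity and nonnegativity so is the
  one at \<open>i\<close>.\<close>

lemma ordered_eigenvalues_rank:
  assumes A: "A \<in> carrier_mat n n" and psd: "positive_semidefinite A"
    and rank: "vec_space.rank n A \<le> i" and i: "i < n"
  shows "ordered_eigenvalues A ! i = 0"
proof -
  interpret vec_space "TYPE(complex)" n .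
  have "hermitian A" using psd by (simp add: positive_semidefinite_def)
  then obtain U where U: "U \<in> carrier_mat n n" "mat_adjoint U * U = 1\<^sub>m n"
      "U * mat_adjoint U = 1\<^sub>m n"
    and spec: "A = U * mat_diag n (\<lambda>i. complex_of_real (ordered_eigenvalues A ! i)) * mat_adjoint U"
    using hermitian_spectral[OF A] by blast
  obtain X Y where X: "X \<in> carrier_mat n (rank A)" and Y: "Y \<in> carrier_mat (rank A) n"
    and XY: "A = X * Y"
    using rank_factorization[OF A] .
  have "Y * U \<in> carrier_mat (rank A) n" using Y U by simp
  then obtain x where x: "x \<in> carrier_vec n" "x \<noteq> 0\<^sub>v n" and YUx: "(Y * U) *\<^sub>v x = 0\<^sub>v (rank A)"
    and supp: "\<And>j. Suc i \<le> j \<Longrightarrow> j < n \<Longrightarrow> x $ j = 0"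
    using wide_system_nontrivial_solution[of "Y * U" "rank A" n "Suc i"] rank i by auto
  define v where "v = U *\<^sub>v x"
  have v: "v \<in> carrier_vec n" using U x by (auto simp: v_def intro: mult_mat_vec_carrier)
  have Uv: "mat_adjoint U *\<^sub>v v = x"
    unfolding v_def using U x by (simp flip: assoc_mult_mat_vec[of _ n n _ n])
  have "A *\<^sub>v v = X *\<^sub>v ((Y * U) *\<^sub>v x)"
    unfolding v_def XY using X Y U x
    by (simp add: assoc_mult_mat_vec[of _ n "rank A" _ n] assoc_mult_mat_vec[of _ "rank A" n _ n])
  also have "\<dots> = 0\<^sub>v n" unfolding YUx using X by auto
  finally have "mat_adjoint U *\<^sub>v (A *\<^sub>v v) = 0\<^sub>v n" using U by auto
  then have zero: "vec n (\<lambda>i. complex_of_real (ordered_eigenvalues A ! i) * x $ i) = 0\<^sub>v n"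
    using spectral_coordinates[OF U(1,2) v, of "\<lambda>i. complex_of_real (ordered_eigenvalues A ! i)"]
    unfolding Uv spec[symmetric] by simp
  obtain j where j: "j < n" "x $ j \<noteq> 0" using x by (metis carrier_vecD eq_vecI index_zero_vec)
  then have "j \<le> i" using supp by (meson not_less_eq_eq)
  have "ordered_eigenvalues A ! j = 0"
    using arg_cong[OF zero, of "\<lambda>w. w $ j"] j by simp
  then show ?thesis
    using ordered_eigenvalues_decreasing[OF \<open>j \<le> i\<close>, of A] length_ordered_eigenvalues[OF A] i
      ordered_eigenvalues_nonneg[OF A psd i] by simp
qed

text \<open>Take \<open>U * M\<close>, where the rectangular \<open>M\<close> has the square roots
  of the eigenvalues on its diagonal. It may have fewer than \<open>n\<close> columns: the
  eigenvalues cut off have index at least \<open>rank A\<close> and vanish.\<close>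

lemma square_root_exists:
  assumes A: "A \<in> carrier_mat n n" and psd: "positive_semidefinite A"
    and rank: "vec_space.rank n A \<le> k"
  obtains F where "square_root n k A F"
proof -
  have "hermitian A" using psd by (simp add: positive_semidefinite_def)
  then obtain U where U: "U \<in> carrier_mat n n" "mat_adjoint U * U = 1\<^sub>m n"
      "U * mat_adjoint U = 1\<^sub>m n"
    and spec: "A = U * mat_diag n (\<lambda>i. complex_of_real (ordered_eigenvalues A ! i)) * mat_adjoint U"
    using hermitian_spectral[OF A] by blast
  let ?d = "\<lambda>i. ordered_eigenvalues A ! i"
  define M where "M = mat n k (\<lambda>(i, j). if i = j then complex_of_real (sqrt (?d i)) else 0)"
  have M: "M \<in> carrier_mat n k" by (simp add: M_def)
  have MM: "M * mat_adjoint M = mat_diag n (\<lambda>i. complex_of_real (?d i))"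
  proof (rule eq_matI)
    fix i j assume "i < dim_row (mat_diag n (\<lambda>i. complex_of_real (?d i)))"
      "j < dim_col (mat_diag n (\<lambda>i. complex_of_real (?d i)))"
    then have ij: "i < n" "j < n" by (auto simp: mat_diag_def)
    have "(M * mat_adjoint M) $$ (i, j) = (\<Sum>l<k. M $$ (i, l) * cnj (M $$ (j, l)))"
      using ij M by (simp add: scalar_prod_def atLeast0LessThan)
    also have "\<dots> = (\<Sum>l<k. if i = l then
        (if i = j then complex_of_real (?d i) else 0) else 0)"
      using ij ordered_eigenvalues_nonneg[OF A psd ij(1)]
      by (intro sum.cong) (auto simp: M_def simp flip: of_real_mult)
    also have "\<dots> = (if i < k \<and> i = j then complex_of_real (?d i) else 0)"
      by simp
    \<comment> \<open>The rank bound enters for \<open>i \<ge> k\<close>, where the left side is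
      0.\<close>
    also have "\<dots> = mat_diag n (\<lambda>i. complex_of_real (?d i)) $$ (i, j)"
      using ij rank ordered_eigenvalues_rank[OF A psd _ ij(1)] by (auto simp: mat_diag_def)
    finally show "(M * mat_adjoint M) $$ (i, j) = mat_diag n (\<lambda>i. complex_of_real (?d i)) $$ (i, j)" .
  qed (auto simp: M_def mat_diag_def)
  have "(U * M) * mat_adjoint (U * M) = U * M * (mat_adjoint M * mat_adjoint U)"
    using U M by (simp add: adjoint_mult[of _ n n _ k])
  also have "\<dots> = U * (M * mat_adjoint M) * mat_adjoint U"
    using U M by (simp add: assoc_mult_mat[of _ n n _ k _ n] assoc_mult_mat[of _ n k _ n _ n]
        assoc_mult_mat[of _ n n _ n _ n] mult_carrier_mat[of _ n k _ n] mult_carrier_mat[of _ k n _ n])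
  also have "\<dots> = A" unfolding MM by (rule spec[symmetric])
  finally show ?thesis using that[of "U * M"] U M by (simp add: square_root_def)
qed

section \<open>Monotonicity of the ordered eigenvalues\<close>

lemma assoc_mult_mat_mat_vec:
  fixes A B C :: "'a :: comm_ring_1 mat"
  assumes A: "A \<in> carrier_mat m n" and B: "B \<in> carrier_mat n l" and C: "C \<in> carrier_mat l k"
    and v: "v \<in> carrier_vec k"
  shows "(A * B * C) *\<^sub>v v = A *\<^sub>v (B *\<^sub>v (C *\<^sub>v v))"
proof -
  have "(A * B * C) *\<^sub>v v = (A * B) *\<^sub>v (C *\<^sub>v v)"
    using mult_carrier_mat[OF A B] C v by (rule assoc_mult_mat_vec)
  also have "\<dots> = A *\<^sub>v (B *\<^sub>v (C *\<^sub>v v))"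
    using A B mult_mat_vec_carrier[OF C v] by (rule assoc_mult_mat_vec)
  finally show ?thesis .
qed

lemma congruence_form:
  fixes P S :: "complex mat"
  assumes P: "P \<in> carrier_mat n n" and S: "S \<in> carrier_mat n k" and v: "v \<in> carrier_vec k"
    and w: "w \<in> carrier_vec k"
  shows "((mat_adjoint S * P * S) *\<^sub>v v) \<bullet>c w = (P *\<^sub>v (S *\<^sub>v v)) \<bullet>c (S *\<^sub>v w)"
proof -
  have Sv: "S *\<^sub>v v \<in> carrier_vec n" using S v by (rule mult_mat_vec_carrier)
  have y: "P *\<^sub>v (S *\<^sub>v v) \<in> carrier_vec n" using P Sv by (rule mult_mat_vec_carrier)
  have "(mat_adjoint S * P * S) *\<^sub>v v = mat_adjoint S *\<^sub>v (P *\<^sub>v (S *\<^sub>v v))"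
    using adjoint_carrier[OF S] P S v by (rule assoc_mult_mat_mat_vec)
  then show ?thesis
    using adjoint_mult_vec[OF adjoint_carrier[OF S] y w] by simp
qed

lemma positive_semidefinite_congruence:
  assumes P: "P \<in> carrier_mat n n" "positive_semidefinite P" and S: "S \<in> carrier_mat n k"
  shows "positive_semidefinite (mat_adjoint S * P * S)"
  unfolding positive_semidefinite_def
proof (intro conjI ballI)
  show "hermitian (mat_adjoint S * P * S)"
    using P S by (intro hermitian_congruence) (auto simp: positive_semidefinite_def)
  fix v :: "complex vec" assume "v \<in> carrier_vec (dim_row (mat_adjoint S * P * S))"
  then have v: "v \<in> carrier_vec k" using S by simp
  then have "S *\<^sub>v v \<in> carrier_vec n" using S mult_mat_vec_carrier by blast
  then show "0 \<le> ((mat_adjoint S * P * S) *\<^sub>v v) \<bullet>c v"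
    using congruence_form[OF P(1) S v v] P by (auto simp: positive_semidefinite_def)
qed

text \<open>With \<open>loewner_le_form\<close>, this turns a Loewner inequality between
  \<open>G * mat_adjoint G\<close> and \<open>F * mat_adjoint F\<close> into a comparison of the
  norms of \<open>mat_adjoint G *\<^sub>v y\<close> and
  \<open>mat_adjoint F *\<^sub>v y\<close>.\<close>

lemma gram_form:
  fixes G :: "complex mat"
  assumes G: "G \<in> carrier_mat n k" and y: "y \<in> carrier_vec n"
  shows "((G * mat_adjoint G) *\<^sub>v y) \<bullet>c y = (mat_adjoint G *\<^sub>v y) \<bullet>c (mat_adjoint G *\<^sub>v y)"
proof -
  have "mat_adjoint G *\<^sub>v y \<in> carrier_vec k"
    using G y by (simp add: mult_mat_vec_carrier[of _ k n])
  then show ?thesis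
    using assms adjoint_mult_vec[OF G _ y] by (simp add: assoc_mult_mat_vec[of _ n k _ n])
qed

lemma loewner_le_form:
  assumes le: "A \<preceq>\<^sub>L B" and A: "A \<in> carrier_mat n n" and B: "B \<in> carrier_mat n n"
    and y: "y \<in> carrier_vec n"
  shows "Re ((A *\<^sub>v y) \<bullet>c y) \<le> Re ((B *\<^sub>v y) \<bullet>c y)"
proof -
  have "0 \<le> ((B - A) *\<^sub>v y) \<bullet>c y"
    using le A y by (auto simp: loewner_le_def positive_semidefinite_def)
  also have "((B - A) *\<^sub>v y) \<bullet>c y = (B *\<^sub>v y) \<bullet>c y - (A *\<^sub>v y) \<bullet>c y"
    using A B y by (simp add: minus_mult_distrib_mat_vec minus_scalar_prod_distrib[of _ n]
        mult_mat_vec_carrier[of _ n n])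
  finally show ?thesis by (simp add: less_eq_complex_def)
qed

lemma cscalar_prod_commute:
  fixes v w :: "complex vec"
  assumes "v \<in> carrier_vec n" "w \<in> carrier_vec n"
  shows "v \<bullet>c w = cnj (w \<bullet>c v)"
  using assms by (simp add: scalar_prod_def mult.commute)

text \<open>The two cross terms are conjugate to each other because \<open>P\<close> is Hermitian,
  so for real \<open>t\<close> their real parts add up to the middle term.\<close>

lemma hermitian_form_diff_smult:
  fixes P :: "complex mat" and t :: real
  assumes P: "P \<in> carrier_mat n n" "hermitian P" and f: "f \<in> carrier_vec n"
    and g: "g \<in> carrier_vec n"
  defines "w \<equiv> f - complex_of_real t \<cdot>\<^sub>v g"
  shows "Re ((P *\<^sub>v w) \<bullet>c w)
    = Re ((P *\<^sub>v f) \<bullet>c f) - 2 * t * Re ((P *\<^sub>v g) \<bullet>c f) + t\<^sup>2 * Re ((P *\<^sub>v g) \<bullet>c g)"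
proof -
  have Pf: "P *\<^sub>v f \<in> carrier_vec n" and Pg: "P *\<^sub>v g \<in> carrier_vec n"
    using P f g by (auto intro: mult_mat_vec_carrier)
  have cw: "conjugate w = conjugate f - complex_of_real t \<cdot>\<^sub>v conjugate g"
    unfolding w_def using f g by (intro eq_vecI) auto
  have Pw: "P *\<^sub>v w = P *\<^sub>v f - complex_of_real t \<cdot>\<^sub>v (P *\<^sub>v g)"
    unfolding w_def using P f g by (simp add: mult_minus_distrib_mat_vec mult_mat_vec)
  have expand: "(P *\<^sub>v w) \<bullet>c w = (P *\<^sub>v f) \<bullet>c f - t * ((P *\<^sub>v f) \<bullet>c g)
      - t * ((P *\<^sub>v g) \<bullet>c f - t * ((P *\<^sub>v g) \<bullet>c g))"
    unfolding Pw cw using Pf Pg f g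
    by (simp add: minus_scalar_prod_distrib[of _ n] scalar_prod_minus_distrib[of _ n]
        right_diff_distrib)
  have cross: "(P *\<^sub>v f) \<bullet>c g = cnj ((P *\<^sub>v g) \<bullet>c f)"
    using adjoint_mult_vec[OF P(1) f g] P(2) cscalar_prod_commute[OF f Pg]
    by (simp add: hermitian_def)
  show ?thesis unfolding expand cross by (simp add: power2_eq_square algebra_simps)
qed

text \<open>A dimension count yields \<open>v\<close> in the span of the first \<open>i + 1\<close> eigenvectors of
  \<open>G\<^sup>H P G\<close> for which \<open>z = F\<^sup>H P G v\<close> is orthogonal to the first \<open>i\<close> eigenvectors of
  \<open>F\<^sup>H P F\<close>. If the eigenvalue \<open>a\<close> of index \<open>i\<close> of \<open>G\<^sup>H P G\<close> were larger than that of
  \<open>F\<^sup>H P F\<close>, then nonnegativity of \<open>P\<close> at \<open>F z - a G v\<close> would be violated.\<close>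

lemma objective_mono:
  assumes P: "P \<in> carrier_mat n n" "positive_semidefinite P"
    and F: "F \<in> carrier_mat n k" and G: "G \<in> carrier_mat n k"
    and le: "G * mat_adjoint G \<preceq>\<^sub>L F * mat_adjoint F" and i: "i < k"
  shows "objective P G ! i \<le> objective P F ! i"
proof (rule ccontr)
  define A where "A = mat_adjoint G * P * G"
  define B where "B = mat_adjoint F * P * F"
  define d where "d = (\<lambda>j. ordered_eigenvalues A ! j)"
  define e where "e = (\<lambda>j. ordered_eigenvalues B ! j)"
  assume "\<not> ?thesis"
  then have less: "e i < d i" by (simp add: objective_def A_def B_def d_def e_def)
  have A: "A \<in> carrier_mat k k" unfolding A_def using P G by auto
  have B: "B \<in> carrier_mat k k" unfolding B_def using P F by auto
  have psd_A: "positive_semidefinite A"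
    unfolding A_def by (rule positive_semidefinite_congruence[OF P G])
  have psd_B: "positive_semidefinite B"
    unfolding B_def by (rule positive_semidefinite_congruence[OF P F])
  have pos: "0 < d i"
    using less ordered_eigenvalues_nonneg[OF B psd_B i] unfolding e_def by linarith
  obtain U where U: "U \<in> carrier_mat k k" "mat_adjoint U * U = 1\<^sub>m k" "U * mat_adjoint U = 1\<^sub>m k"
    and spec_A: "A = U * mat_diag k (\<lambda>j. complex_of_real (d j)) * mat_adjoint U"
    using hermitian_spectral[OF A] psd_A unfolding positive_semidefinite_def d_def by blast
  obtain W where W: "W \<in> carrier_mat k k" "mat_adjoint W * W = 1\<^sub>m k" "W * mat_adjoint W = 1\<^sub>m k"
    and spec_B: "B = W * mat_diag k (\<lambda>j. complex_of_real (e j)) * mat_adjoint W"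
    using hermitian_spectral[OF B] psd_B unfolding positive_semidefinite_def e_def by blast
  \<comment> \<open>\<open>T\<close> maps \<open>v\<close> to \<open>z\<close>, and \<open>S\<close>
    does the same between the coordinates in the eigenbases \<open>U\<close> and
    \<open>W\<close>.\<close>
  define T where "T = mat_adjoint F * P * G"
  have T: "T \<in> carrier_mat k k" unfolding T_def using P F G by auto
  define S where "S = mat_adjoint W * (T * U)"
  have S: "S \<in> carrier_mat k k" unfolding S_def using W T U by auto
  \<comment> \<open>The first \<open>i\<close> rows of \<open>S\<close> give \<open>i\<close>
    equations, one fewer than the \<open>i + 1\<close> coordinates on which \<open>x\<close> may
    live.\<close>
  define C where "C = mat i k (\<lambda>(r, c). S $$ (r, c))"
  have C: "C \<in> carrier_mat i k" by (simp add: C_def)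
  obtain x where x: "x \<in> carrier_vec k" "x \<noteq> 0\<^sub>v k" and Cx: "C *\<^sub>v x = 0\<^sub>v i"
    and supp: "\<And>j. Suc i \<le> j \<Longrightarrow> j < k \<Longrightarrow> x $ j = 0"
    using wide_system_nontrivial_solution[OF C, of "Suc i"] i by auto
  define v where "v = U *\<^sub>v x"
  define g where "g = G *\<^sub>v v"
  define y where "y = P *\<^sub>v g"
  define z where "z = mat_adjoint F *\<^sub>v y"
  define f where "f = F *\<^sub>v z"
  have v: "v \<in> carrier_vec k" unfolding v_def using U(1) x(1) by (rule mult_mat_vec_carrier)
  have g: "g \<in> carrier_vec n" unfolding g_def using G v by (rule mult_mat_vec_carrier)
  have y: "y \<in> carrier_vec n" unfolding y_def using P(1) g by (rule mult_mat_vec_carrier)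
  have z: "z \<in> carrier_vec k"
    unfolding z_def using adjoint_carrier[OF F] y by (rule mult_mat_vec_carrier)
  have f: "f \<in> carrier_vec n" unfolding f_def using F z by (rule mult_mat_vec_carrier)
  have Uv: "mat_adjoint U *\<^sub>v v = x"
    unfolding v_def using U x by (simp flip: assoc_mult_mat_vec[of _ k k _ k])
  have Av: "A *\<^sub>v v = mat_adjoint G *\<^sub>v y"
    unfolding A_def y_def g_def
    using adjoint_carrier[OF G] P(1) G v by (rule assoc_mult_mat_mat_vec)
  have zT: "z = T *\<^sub>v v"
    unfolding T_def z_def y_def g_def
    using adjoint_carrier[OF F] P(1) G v by (rule assoc_mult_mat_mat_vec[symmetric])
  have Wz: "mat_adjoint W *\<^sub>v z = S *\<^sub>v x"
    unfolding zT S_def v_def using W T U x v[unfolded v_def]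
    by (simp add: assoc_mult_mat_vec[of _ k k _ k] mult_carrier_mat[of _ k k _ k])
  have Wz0: "(mat_adjoint W *\<^sub>v z) $ j = 0" if j: "j < i" for j
  proof -
    have "row C j = row S j" using j i S by (intro eq_vecI) (auto simp: C_def)
    then show ?thesis
      using arg_cong[OF Cx, of "\<lambda>w. w $ j"] C S j i unfolding Wz by simp
  qed
  have Pg_g: "Re (y \<bullet>c g) = (\<Sum>j<k. d j * (cmod (x $ j))\<^sup>2)"
    using spectral_form(1)[OF U spec_A v] congruence_form[OF P(1) G v v]
    unfolding Uv by (simp add: A_def g_def y_def)
  have Av_Av: "Re ((A *\<^sub>v v) \<bullet>c (A *\<^sub>v v)) = (\<Sum>j<k. (d j)\<^sup>2 * (cmod (x $ j))\<^sup>2)"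
    using spectral_form(2)[OF U spec_A v] unfolding Uv by simp
  have d_ge: "d i \<le> d j" if "j \<le> i" for j
    using ordered_eigenvalues_decreasing[OF that, of A] length_ordered_eigenvalues[OF A] i
    by (simp add: d_def)
  \<comment> \<open>\<open>x\<close> lives on indices \<open>j \<le> i\<close>, where
    \<open>d j \<ge> d i > 0\<close>, so replacing one factor \<open>d j\<close> by
    \<open>d i\<close> can only decrease the sum.\<close>
  have lower: "d i * Re (y \<bullet>c g) \<le> Re ((A *\<^sub>v v) \<bullet>c (A *\<^sub>v v))"
    unfolding Pg_g Av_Av sum_distrib_left
  proof (rule sum_mono)
    fix j assume "j \<in> {..<k}"
    then have j: "j < k" by simp
    show "d i * (d j * (cmod (x $ j))\<^sup>2) \<le> (d j)\<^sup>2 * (cmod (x $ j))\<^sup>2"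
    proof (cases "j \<le> i")
      case True
      then have "d i * d j \<le> d j * d j" using d_ge[OF True] pos by (intro mult_right_mono) auto
      then show ?thesis
        by (simp add: power2_eq_square[of "d j"] mult.assoc[symmetric] mult_right_mono)
    qed (use supp j in simp)
  qed
  \<comment> \<open>Strict positivity excludes \<open>z = 0\<close>, so that the final inequality
    can be divided by the squared norm of \<open>z\<close>.\<close>
  have "0 < (\<Sum>j<k. (d j)\<^sup>2 * (cmod (x $ j))\<^sup>2)"
  proof -
    obtain j where j: "j < k" "x $ j \<noteq> 0" using x by (metis carrier_vecD eq_vecI index_zero_vec)
    then have "0 < d j" using supp d_ge[of j] pos by (metis less_le_trans not_less_eq_eq)
    then show ?thesis using j by (intro sum_pos2[of _ j]) auto
  qed
  \<comment> \<open>The Loewner hypothesis is tested at \<open>y\<close>: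
    \<open>A *\<^sub>v v\<close> is \<open>mat_adjoint G *\<^sub>v y\<close>, and \<open>z\<close>
    is \<open>mat_adjoint F *\<^sub>v y\<close>.\<close>
  moreover have "Re ((A *\<^sub>v v) \<bullet>c (A *\<^sub>v v)) \<le> Re (z \<bullet>c z)"
  proof -
    have GG: "G * mat_adjoint G \<in> carrier_mat n n" and FF: "F * mat_adjoint F \<in> carrier_mat n n"
      using F G by auto
    show ?thesis
      using loewner_le_form[OF le GG FF y] unfolding gram_form[OF G y] gram_form[OF F y]
      by (simp add: Av z_def)
  qed
  ultimately have z_pos: "0 < Re (z \<bullet>c z)" and z_ge: "d i * Re (y \<bullet>c g) \<le> Re (z \<bullet>c z)"
    using lower unfolding Av_Av by auto
  \<comment> \<open>Since \<open>y = P *\<^sub>v g\<close>, the cross term of the form of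
    \<open>P\<close> at \<open>g\<close> and \<open>f\<close> is the squared norm of
    \<open>z\<close>.\<close>
  have yf: "y \<bullet>c f = z \<bullet>c z"
    using adjoint_mult_vec[OF adjoint_carrier[OF F] y z] by (simp add: f_def z_def)
  \<comment> \<open>\<open>z\<close> has no components along the first \<open>i\<close> columns of
    \<open>W\<close>, and the remaining eigenvalues of \<open>B\<close> are at most
    \<open>e i\<close>.\<close>
  have "Re ((P *\<^sub>v f) \<bullet>c f) \<le> e i * Re (z \<bullet>c z)"
  proof -
    have "(P *\<^sub>v f) \<bullet>c f = (B *\<^sub>v z) \<bullet>c z"
      unfolding f_def B_def by (rule congruence_form[OF P(1) F z z, symmetric])
    then have "Re ((P *\<^sub>v f) \<bullet>c f) = (\<Sum>j<k. e j * (cmod ((mat_adjoint W *\<^sub>v z) $ j))\<^sup>2)"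
      using spectral_form(1)[OF W spec_B z] by simp
    also have "\<dots> \<le> (\<Sum>j<k. e i * (cmod ((mat_adjoint W *\<^sub>v z) $ j))\<^sup>2)"
    proof (rule sum_mono)
      fix j assume "j \<in> {..<k}"
      then have j: "j < k" by simp
      show "e j * (cmod ((mat_adjoint W *\<^sub>v z) $ j))\<^sup>2 \<le> e i * (cmod ((mat_adjoint W *\<^sub>v z) $ j))\<^sup>2"
      proof (cases "j < i")
        case False
        then have "e j \<le> e i"
          using ordered_eigenvalues_decreasing[of i j B] length_ordered_eigenvalues[OF B] j
          by (simp add: e_def)
        then show ?thesis by (intro mult_right_mono) auto
      qed (simp add: Wz0)
    qed
    also have "\<dots> = e i * Re (z \<bullet>c z)"
      using spectral_form(3)[OF W spec_B z] by (simp add: sum_distrib_left)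
    finally show ?thesis .
  qed
  moreover have "0 \<le> Re ((P *\<^sub>v f) \<bullet>c f) - 2 * d i * Re (z \<bullet>c z) + (d i)\<^sup>2 * Re (y \<bullet>c g)"
  proof -
    let ?w = "f - complex_of_real (d i) \<cdot>\<^sub>v g"
    have "?w \<in> carrier_vec n" using f g by simp
    then have "0 \<le> Re ((P *\<^sub>v ?w) \<bullet>c ?w)"
      using P by (auto simp: positive_semidefinite_def less_eq_complex_def)
    moreover have "hermitian P" using P(2) by (simp add: positive_semidefinite_def)
    ultimately show ?thesis
      using hermitian_form_diff_smult[OF P(1) _ f g, of "d i"] yf by (simp add: y_def)
  qed
  \<comment> \<open>Half of the negative middle term absorbs this quadratic term; the other half
    gives the contradiction with \<open>e i < d i\<close>.\<close>
  moreover have "(d i)\<^sup>2 * Re (y \<bullet>c g) \<le> d i * Re (z \<bullet>c z)"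
    using mult_left_mono[OF z_ge, of "d i"] pos by (simp add: power2_eq_square mult.assoc)
  ultimately have "d i * Re (z \<bullet>c z) \<le> e i * Re (z \<bullet>c z)" by linarith
  then show False using z_pos less by simp
qed

section \<open>Trace and uniqueness of the maximizer\<close>

definition mat_trace :: "'a :: comm_monoid_add mat \<Rightarrow> 'a" where
  "mat_trace A = (\<Sum>i<dim_row A. A $$ (i, i))"

lemma mat_trace_commute:
  fixes A B :: "'a :: comm_semiring_0 mat"
  assumes A: "A \<in> carrier_mat n k" and B: "B \<in> carrier_mat k n"
  shows "mat_trace (A * B) = mat_trace (B * A)"
proof -
  have "mat_trace (A * B) = (\<Sum>i<n. \<Sum>j<k. A $$ (i, j) * B $$ (j, i))"
    using A B by (simp add: mat_trace_def scalar_prod_def atLeast0LessThan)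
  also have "\<dots> = (\<Sum>j<k. \<Sum>i<n. A $$ (i, j) * B $$ (j, i))"
    by (rule sum.swap)
  also have "\<dots> = mat_trace (B * A)"
    using A B by (simp add: mat_trace_def scalar_prod_def atLeast0LessThan mult.commute)
  finally show ?thesis .
qed

text \<open>Cyclicity of the trace cancels the unitary factors. This makes the sum of the
  eigenvalues linear in the matrix.\<close>

lemma mat_trace_ordered_eigenvalues:
  assumes A: "A \<in> carrier_mat n n" and herm: "hermitian A"
  shows "mat_trace A = complex_of_real (\<Sum>i<n. ordered_eigenvalues A ! i)"
proof -
  let ?D = "mat_diag n (\<lambda>i. complex_of_real (ordered_eigenvalues A ! i))"
  obtain U where U: "U \<in> carrier_mat n n" "mat_adjoint U * U = 1\<^sub>m n"
    and spec: "A = U * ?D * mat_adjoint U"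
    using hermitian_spectral[OF A herm] by blast
  have D: "?D \<in> carrier_mat n n" by simp
  have UD: "U * ?D \<in> carrier_mat n n" using U(1) D by (rule mult_carrier_mat)
  have "mat_trace A = mat_trace (mat_adjoint U * (U * ?D))"
    by (subst spec) (rule mat_trace_commute[OF UD adjoint_carrier[OF U(1)]])
  also have "mat_adjoint U * (U * ?D) = mat_adjoint U * U * ?D"
    using adjoint_carrier[OF U(1)] U(1) D by (rule assoc_mult_mat[symmetric])
  also have "\<dots> = ?D" unfolding U(2) by (rule left_mult_one_mat[OF D])
  finally show ?thesis by (simp add: mat_trace_def mat_diag_def)
qed

text \<open>With \<open>D = Q * mat_adjoint Q\<close>, cyclicity turns the trace into the sum of the
  values of the form of \<open>P\<close> at the columns of \<open>Q\<close>. These are nonnegative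
  with sum 0, so each is 0 and definiteness kills every column.\<close>

lemma positive_definite_trace_eq_0:
  assumes P: "P \<in> carrier_mat n n" "positive_definite P"
    and D: "D \<in> carrier_mat n n" "positive_semidefinite D"
    and trace: "mat_trace (P * D) = 0"
  shows "D = 0\<^sub>m n n"
proof -
  obtain Q where "square_root n n D Q"
    using square_root_exists[OF D vec_space.rank_le_nc[OF D(1)]] .
  then have Q: "Q \<in> carrier_mat n n" and QQ: "Q * mat_adjoint Q = D"
    by (auto simp: square_root_def)
  have col: "col Q i \<in> carrier_vec n" if "i < n" for i using Q that by (intro col_carrier_vec)
  have nonneg: "0 \<le> Re ((P *\<^sub>v col Q i) \<bullet>c col Q i)" if "i < n" for i
    using col[OF that] P
    by (cases "col Q i = 0\<^sub>v n") (auto simp: positive_definite_def less_complex_def)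
  have "mat_trace (P * D) = mat_trace (P * Q * mat_adjoint Q)"
    unfolding QQ[symmetric] using P Q by (simp add: assoc_mult_mat[of _ n n _ n _ n])
  also have "\<dots> = mat_trace (mat_adjoint Q * (P * Q))"
    using P Q by (intro mat_trace_commute[of _ n n]) auto
  also have "\<dots> = (\<Sum>i<n. (P *\<^sub>v col Q i) \<bullet>c col Q i)"
  proof -
    have "(mat_adjoint Q * (P * Q)) $$ (i, i) = (P *\<^sub>v col Q i) \<bullet>c col Q i" if i: "i < n" for i
    proof -
      have "col (P * Q) i = P *\<^sub>v col Q i" using P Q i by (intro col_mult2) auto
      moreover have "row (mat_adjoint Q) i = conjugate (col Q i)"
        using Q i by (intro eq_vecI) auto
      moreover have "conjugate (col Q i) \<bullet> (P *\<^sub>v col Q i) = (P *\<^sub>v col Q i) \<bullet>c col Q i"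
        using P col[OF i] by (intro comm_scalar_prod[of _ n]) (auto simp: mult_mat_vec_carrier[of _ n n])
      ultimately show ?thesis using P Q i by simp
    qed
    then show ?thesis using Q by (simp add: mat_trace_def)
  qed
  finally have "(\<Sum>i<n. Re ((P *\<^sub>v col Q i) \<bullet>c col Q i)) = 0"
    using trace by (simp flip: Re_sum)
  then have zero: "Re ((P *\<^sub>v col Q i) \<bullet>c col Q i) = 0" if "i < n" for i
    using nonneg that by (subst (asm) sum_nonneg_eq_0_iff) auto
  have "col Q i = 0\<^sub>v n" if i: "i < n" for i
  proof (rule ccontr)
    assume "col Q i \<noteq> 0\<^sub>v n"
    then have "0 < (P *\<^sub>v col Q i) \<bullet>c col Q i"
      using P col[OF i] by (auto simp: positive_definite_def)
    then show False using zero[OF i] by (simp add: less_complex_def)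
  qed
  then have "Q = 0\<^sub>m n n"
    using Q by (intro mat_col_eqI) auto
  then show ?thesis using QQ by (metis left_mult_zero_mat adjoint_carrier zero_carrier_mat)
qed

section \<open>Optimality of square roots\<close>

lemma square_root_feasible:
  assumes "R \<in> carrier_mat n n" "positive_semidefinite R" "square_root n k R F"
  shows "feasible n k R F"
proof -
  have "R - R = 0\<^sub>m n n" using assms(1) by (intro eq_matI) auto
  moreover have "0\<^sub>m n n *\<^sub>v v = 0\<^sub>v n" if "v \<in> carrier_vec n" for v :: "complex vec"
    using that by (intro eq_vecI) auto
  then have "positive_semidefinite (0\<^sub>m n n)"
    by (auto simp: positive_semidefinite_def hermitian_def intro!: eq_matI)
  ultimately show ?thesis
    using assms by (simp add: feasible_def square_root_def loewner_le_def positive_semidefinite_def)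
qed

text \<open>Once \<open>R\<close> is written as \<open>F * mat_adjoint F\<close>, feasibility of
  \<open>G\<close> is the Loewner hypothesis of \<open>objective_mono\<close>.\<close>

lemma square_root_optimal:
  assumes P: "P \<in> carrier_mat n n" "positive_semidefinite P"
    and R: "R \<in> carrier_mat n n" "positive_semidefinite R" and F: "square_root n k R F"
  shows "optimal_solution n k P R F"
  unfolding optimal_solution_def
proof (intro conjI allI impI)
  show "feasible n k R F" by (rule square_root_feasible[OF R F])
  fix G i assume "feasible n k R G" "i < k"
  then show "objective P G ! i \<le> objective P F ! i"
    using F by (intro objective_mono[OF P]) (auto simp: feasible_def square_root_def)
qed

text \<open>By cyclicity, the sum of the objective entries depends on \<open>F\<close> only through
  \<open>F * mat_adjoint F\<close>, and linearly, so equal objectives become a linear equation on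
  the constrained matrix.\<close>

lemma objective_trace:
  assumes P: "P \<in> carrier_mat n n" "positive_semidefinite P" and F: "F \<in> carrier_mat n k"
  shows "mat_trace (P * (F * mat_adjoint F)) = complex_of_real (\<Sum>i<k. objective P F ! i)"
proof -
  have "mat_trace (P * (F * mat_adjoint F)) = mat_trace (P * F * mat_adjoint F)"
    using P F by (simp add: assoc_mult_mat[of _ n n _ k _ n])
  also have "\<dots> = mat_trace (mat_adjoint F * (P * F))"
    using P F by (intro mat_trace_commute[of _ n k]) auto
  also have "mat_adjoint F * (P * F) = mat_adjoint F * P * F"
    using P F by (simp add: assoc_mult_mat[of _ k n _ n _ k])
  also have "mat_trace \<dots> = complex_of_real (\<Sum>i<k. objective P F ! i)"
    unfolding objective_def using P F positive_semidefinite_congruence[OF P F]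
    by (intro mat_trace_ordered_eigenvalues) (auto simp: positive_semidefinite_def)
  finally show ?thesis .
qed

text \<open>The converse is restricted to positive definite \<open>P\<close>: for
  \<open>P = 0\<close> every feasible \<open>F\<close> is optimal, including the zero matrix. The
  existence conjunct, with the second one, shows that the maximum is attained.\<close>

theorem lemma1:
  fixes N L :: nat and P R :: "complex mat"
  assumes "P \<in> carrier_mat N N" and "positive_semidefinite P"
    and "R \<in> carrier_mat N N" and "positive_semidefinite R"
    and attainable: "vec_space.rank N R \<le> L" "vec_space.rank N R \<le> N"
  shows "(\<exists>F. square_root N L R F) \<and>
    (\<forall>F. square_root N L R F \<longrightarrow> optimal_solution N L P R F) \<and>
    (positive_definite P \<longrightarrow>
      (\<forall>F. optimal_solution N L P R F \<longrightarrow> square_root N L R F))"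
proof (intro conjI allI impI)
  note P = assms(1,2) and R = assms(3,4)
  obtain F0 where F0: "square_root N L R F0"
    using square_root_exists[OF R attainable(1)] .
  then show "\<exists>F. square_root N L R F" by blast
  show "optimal_solution N L P R F" if "square_root N L R F" for F
    using P R that by (rule square_root_optimal)
  fix F assume pd: "positive_definite P" and opt: "optimal_solution N L P R F"
  have F: "F \<in> carrier_mat N L" and le: "F * mat_adjoint F \<preceq>\<^sub>L R"
    using opt by (auto simp: optimal_solution_def feasible_def)
  have F0_carrier: "F0 \<in> carrier_mat N L" and F0_R: "F0 * mat_adjoint F0 = R"
    using F0 by (auto simp: square_root_def)
  have FF: "F * mat_adjoint F \<in> carrier_mat N N" using F by auto
  \<comment> \<open>Both matrices are feasible and optimal, so each dominates the other entry by
    entry.\<close>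
  have "objective P F ! i = objective P F0 ! i" if "i < L" for i
    using opt square_root_optimal[OF P R F0] that
    by (auto simp: optimal_solution_def intro: order.antisym)
  then have "mat_trace (P * (F * mat_adjoint F)) = mat_trace (P * R)"
    unfolding objective_trace[OF P F] F0_R[symmetric] objective_trace[OF P F0_carrier] by simp
  moreover have "mat_trace (P * (R - F * mat_adjoint F))
      = mat_trace (P * R) - mat_trace (P * (F * mat_adjoint F))"
  proof -
    have "P * (R - F * mat_adjoint F) = P * R - P * (F * mat_adjoint F)"
      using P(1) R(1) FF by (rule mult_minus_distrib_mat)
    then show ?thesis
      using P(1) R(1) FF F by (simp add: mat_trace_def sum_subtractf)
  qed
  ultimately have "mat_trace (P * (R - F * mat_adjoint F)) = 0" by simp
  moreover have "positive_semidefinite (R - F * mat_adjoint F)"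
    using le by (simp add: loewner_le_def)
  ultimately have zero: "R - F * mat_adjoint F = 0\<^sub>m N N"
    using P(1) pd minus_carrier_mat[OF FF] by (intro positive_definite_trace_eq_0[of P])
  have "F * mat_adjoint F = R"
  proof (rule eq_matI)
    fix i j assume "i < dim_row R" "j < dim_col R"
    then show "(F * mat_adjoint F) $$ (i, j) = R $$ (i, j)"
      using arg_cong[OF zero, of "\<lambda>M. M $$ (i, j)"] R(1) F by simp
  qed (use R(1) F in auto)
  then show "square_root N L R F" using F by (simp add: square_root_def)
qed

end
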